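(* Let $r, p', N_t, N_s$ be positive integers, and let $\hat{\mathbf{Y}}_s, \hat{\mathbf{Z}}_s \in \mathbb{R}^{r\times N_t}$ and $\boldsymbol{\nu}_s\in\mathbb{R}^{p'}$ for $s=1,\ldots,N_s$. A tensor $\bar{\mathbf{T}}\in\mathbb{R}^{r\times r\times p'}$ minimizes (over $\mathbb{R}^{r\times r\times p'}$) the function $$L(\bar{\mathbf{T}}) = \frac{1}{2}\sum_{s=1}^{N_s}\left\|\hat{\mathbf{Z}}_s - (\bar{\mathbf{T}}\boldsymbol{\nu}_s)\hat{\mathbf{Y}}_s\right\|^2$$ if and only if the matrix $\bar{T} := \mathrm{cvec}_{23}\,\bar{\mathbf{T}}\in\mathbb{R}^{r\times rp'}$ satisfies the linear system $$\hat{B}\,\bar{T}^{\mathsf{T}} = \hat{C}^{\mathsf{T}},$$ where $\hat{B}\in\mathbb{R}^{rp'\times rp'}$ and $\hat{C}\in\mathbb{R}^{r\times rp'}$ are defined by $$\hat{B} = \mathrm{rvec}_{12}\,\mathrm{cvec}_{34}\left(\sum_{s=1}^{N_s}\boldsymbol{\nu}_s\otimes\hat{\mathbf{Y}}_s\hat{\mathbf{Y}}_s^{\mathsf{T}}\otimes\boldsymbol{\nu}_s\right),\qquad \hat{C} = \mathrm{cvec}_{23}\left(\sum_{s=1}^{N_s}\hat{\mathbf{Z}}_s\hat{\mathbf{Y}}_s^{\mathsf{T}}\otimes\boldsymbol{\nu}_s\right).$$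
   Context: All indices start at 1. $\|F\|^2=\sum_{ij}F_{ij}^2$ is the squared Frobenius norm. For $\bar{\mathbf{T}}\in\mathbb{R}^{r\times r\times p'}$ and $\boldsymbol{\nu}\in\mathbb{R}^{p'}$, $\bar{\mathbf{T}}\boldsymbol{\nu}\in\mathbb{R}^{r\times r}$ is the contraction over the last index: $(\bar{\mathbf{T}}\boldsymbol{\nu})_{ab}=\sum_{x=1}^{p'}\bar{\mathrm{T}}_{abx}\nu_x$. $\otimes$ is the outer product of tensors: $(\mathbf{A}\otimes\mathbf{B})_{i_1,\ldots,i_m,k_1,\ldots,k_n}=\mathrm{A}_{i_1,\ldots,i_m}\mathrm{B}_{k_1,\ldots,k_n}$. For instance $\boldsymbol{\nu}\otimes G\otimes\boldsymbol{\nu}$ with $G\in\mathbb{R}^{r\times r}$ lies in $\mathbb{R}^{p'\times r\times r\times p'}$ and has entries $\nu_x G_{ij}\nu_y$ at position $(x,i,j,y)$. Partial vectorizations: for an order-$n$ tensor $\mathbf{B}\in\mathbb{R}^{N_1\times\cdots\times N_n}$ and $i<j$, $\mathrm{cvec}_{ij}\mathbf{B}$ and $\mathrm{rvec}_{ij}\mathbf{B}$ are the order-$(n-1)$ tensors obtained by merging indices $k_i$ and $k_j$ into a single index of size $N_iN_j$ located at position $i$ (the $j$-th position is removed and the other indices keep their order). The merged index equals $(k_j-1)N_i+k_i$ for $\mathrm{cvec}_{ij}$ (column-wise) and $(k_i-1)N_j+k_j$ for $\mathrm{rvec}_{ij}$ (row-wise); the entries are those of $\mathbf{B}$. Compositions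 are applied right to left, with positions referring to the tensor being operated on. Explicitly: $\bar{T}_{a,(x-1)r+b}=\bar{\mathrm{T}}_{abx}$; $\hat{C}_{a,(x-1)r+b}=\sum_s(\hat{\mathbf{Z}}_s\hat{\mathbf{Y}}_s^{\mathsf{T}})_{ab}(\boldsymbol{\nu}_s)_x$; $\hat{B}_{(x-1)r+i,\,(y-1)r+j}=\sum_s(\boldsymbol{\nu}_s)_x(\hat{\mathbf{Y}}_s\hat{\mathbf{Y}}_s^{\mathsf{T}})_{ij}(\boldsymbol{\nu}_s)_y$. *)

theory Defs
  imports "Jordan_Normal_Form.Matrix"
begin

text \<open>
  Matrices and vectors are those of \<^theory>\<open>Jordan_Normal_Form.Matrix\<close>, whose entries are indexed
  from 0. Tensor entries are indexed from 0 in the same way, so every entry index is the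
  traditional 1-based one shifted down by one. The positions \<open>i < j\<close> in \<open>cvec i j\<close> and
  \<open>rvec i j\<close> do count from 1.

  A tensor is a list of dimensions together with its entries, normalised to be 0 outside the index
  range so that equality of tensors is equality of dimensions and of in-range entries.
\<close>

definition valid_index :: "nat list \<Rightarrow> nat list \<Rightarrow> bool" where
  "valid_index ds ks \<longleftrightarrow> list_all2 (<) ks ds"

typedef tensor =
  "{(ds, f). \<forall>ks. \<not> valid_index ds ks \<longrightarrow> f ks = 0} :: (nat list \<times> (nat list \<Rightarrow> real)) set"
  morphisms rep_tensor abs_tensor
  by (intro exI[of _ "([], \<lambda>_. 0)"]) simp

definition tensor :: "nat list \<Rightarrow> (nat list \<Rightarrow> real) \<Rightarrow> tensor" where
  "tensor ds f = abs_tensor (ds, \<lambda>ks. if valid_index ds ks then f ks else 0)"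

definition dims :: "tensor \<Rightarrow> nat list" where
  "dims A = fst (rep_tensor A)"

definition entry :: "tensor \<Rightarrow> nat list \<Rightarrow> real" where
  "entry A = snd (rep_tensor A)"

definition carrier_tensor :: "nat list \<Rightarrow> tensor set" where
  "carrier_tensor ds = {A. dims A = ds}"

lemma rep_tensor_tensor:
  "rep_tensor (tensor ds f) = (ds, \<lambda>ks. if valid_index ds ks then f ks else 0)"
  unfolding tensor_def by (rule abs_tensor_inverse) simp

lemma dims_tensor [simp]: "dims (tensor ds f) = ds"
  by (simp add: dims_def rep_tensor_tensor)

lemma entry_tensor: "entry (tensor ds f) ks = (if valid_index ds ks then f ks else 0)"
  by (simp add: entry_def rep_tensor_tensor)

lemma entry_outside: "\<not> valid_index (dims A) ks \<Longrightarrow> entry A ks = 0"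
  using rep_tensor[of A] by (auto simp: dims_def entry_def split: prod.splits)

lemma tensor_eqI:
  assumes "dims A = dims B" and "\<And>ks. valid_index (dims A) ks \<Longrightarrow> entry A ks = entry B ks"
  shows "A = B"
proof -
  have "entry A ks = entry B ks" for ks
    using assms entry_outside[of A ks] entry_outside[of B ks] by (cases "valid_index (dims A) ks") auto
  then have "rep_tensor A = rep_tensor B"
    using assms(1) by (intro prod_eqI ext) (auto simp: dims_def entry_def)
  then show ?thesis by (simp add: rep_tensor_inject)
qed

lemma valid_index_simps [simp]:
  "valid_index [] ks \<longleftrightarrow> ks = []"
  "valid_index ds [] \<longleftrightarrow> ds = []"
  "valid_index (d # ds) (k # ks) \<longleftrightarrow> k < d \<and> valid_index ds ks"
  by (auto simp: valid_index_def)

definition tensor_of_vec :: "real vec \<Rightarrow> tensor" where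
  "tensor_of_vec v = tensor [dim_vec v] (\<lambda>ks. v $ (ks ! 0))"

definition tensor_of_mat :: "real mat \<Rightarrow> tensor" where
  "tensor_of_mat A = tensor [dim_row A, dim_col A] (\<lambda>ks. A $$ (ks ! 0, ks ! 1))"

definition mat_of_tensor :: "tensor \<Rightarrow> real mat" where
  "mat_of_tensor A = mat (dims A ! 0) (dims A ! 1) (\<lambda>(i, j). entry A [i, j])"

definition outer_prod :: "tensor \<Rightarrow> tensor \<Rightarrow> tensor"  (infixr "\<otimes>\<^sub>t" 70) where
  "A \<otimes>\<^sub>t B = tensor (dims A @ dims B)
     (\<lambda>ks. entry A (take (length (dims A)) ks) * entry B (drop (length (dims A)) ks))"

text \<open>Finite sum of tensors of the common shape \<open>ds\<close>.\<close>

definition sum_tensor :: "nat list \<Rightarrow> ('a \<Rightarrow> tensor) \<Rightarrow> 'a set \<Rightarrow> tensor" where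
  "sum_tensor ds A S = tensor ds (\<lambda>ks. \<Sum>s\<in>S. entry (A s) ks)"

text \<open>Contraction of an order-3 tensor with a vector over the last index.\<close>

definition contract_last :: "tensor \<Rightarrow> real vec \<Rightarrow> real mat" where
  "contract_last T v = mat (dims T ! 0) (dims T ! 1)
     (\<lambda>(a, b). \<Sum>x<dims T ! 2. entry T [a, b, x] * v $ x)"

text \<open>
  Partial vectorizations. Shifted to indices from 0, the merged index \<open>m\<close> is \<open>k\<^sub>j N\<^sub>i + k\<^sub>i\<close> for
  \<open>cvec\<close> and \<open>k\<^sub>i N\<^sub>j + k\<^sub>j\<close> for \<open>rvec\<close>. The definitions recover \<open>k\<^sub>i, k\<^sub>j\<close> from \<open>m\<close> by division
  with remainder; the lemmas \<open>entry_cvec\<close> and \<open>entry_rvec\<close> below give the merged form.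
\<close>

definition delete_pos :: "nat \<Rightarrow> 'a list \<Rightarrow> 'a list" where
  "delete_pos j xs = take (j - 1) xs @ drop j xs"

definition insert_pos :: "nat \<Rightarrow> 'a \<Rightarrow> 'a list \<Rightarrow> 'a list" where
  "insert_pos j x xs = take (j - 1) xs @ x # drop (j - 1) xs"

definition merge_list :: "nat \<Rightarrow> nat \<Rightarrow> nat \<Rightarrow> nat list \<Rightarrow> nat list" where
  "merge_list i j m ks = delete_pos j (ks[i - 1 := m])"

definition unmerge_list :: "nat \<Rightarrow> nat \<Rightarrow> nat \<Rightarrow> nat \<Rightarrow> nat list \<Rightarrow> nat list" where
  "unmerge_list i j k l ks = insert_pos j l (ks[i - 1 := k])"

definition cvec :: "nat \<Rightarrow> nat \<Rightarrow> tensor \<Rightarrow> tensor" where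
  "cvec i j B = (let Ni = dims B ! (i - 1); Nj = dims B ! (j - 1) in
     tensor (merge_list i j (Ni * Nj) (dims B))
       (\<lambda>ks. let m = ks ! (i - 1) in entry B (unmerge_list i j (m mod Ni) (m div Ni) ks)))"

definition rvec :: "nat \<Rightarrow> nat \<Rightarrow> tensor \<Rightarrow> tensor" where
  "rvec i j B = (let Ni = dims B ! (i - 1); Nj = dims B ! (j - 1) in
     tensor (merge_list i j (Ni * Nj) (dims B))
       (\<lambda>ks. let m = ks ! (i - 1) in entry B (unmerge_list i j (m div Nj) (m mod Nj) ks)))"

lemma unmerge_merge_list:
  assumes "1 \<le> i" "i < j" "j \<le> length ks"
  shows "unmerge_list i j (ks ! (i - 1)) (ks ! (j - 1)) (merge_list i j m ks) = ks"
proof -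
  have 1: "take (j - 1) (ks[i - 1 := m]) = (take (j - 1) ks)[i - 1 := m]"
    by (simp add: take_update_swap)
  have 2: "drop j (ks[i - 1 := m]) = drop j ks" using assms by simp
  have 3: "drop (j - 1) ks = ks ! (j - 1) # drop j ks"
    using assms Cons_nth_drop_Suc[of "j - 1" ks] by simp
  have 4: "(take (j - 1) ks)[i - 1 := ks ! (i - 1)] = take (j - 1) ks"
    using assms by (metis list_update_id take_update_swap)
  have 5: "((take (j - 1) ks)[i - 1 := m] @ drop j ks)[i - 1 := ks ! (i - 1)] =
      take (j - 1) ks @ drop j ks"
    using assms 4 by (simp add: list_update_append)
  have "unmerge_list i j (ks ! (i - 1)) (ks ! (j - 1)) (merge_list i j m ks) =
      take (j - 1) ks @ ks ! (j - 1) # drop j ks"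
    using assms unfolding unmerge_list_def merge_list_def delete_pos_def insert_pos_def 1 2 5 by simp
  also have "\<dots> = ks" using 3 append_take_drop_id[of "j - 1" ks] by simp
  finally show ?thesis .
qed

lemma nth_merge_list:
  assumes "1 \<le> i" "i < j" "j \<le> length ks"
  shows "merge_list i j m ks ! (i - 1) = m"
proof -
  have "i - 1 < j - 1" using assms by simp
  then show ?thesis using assms by (simp add: merge_list_def delete_pos_def nth_append)
qed

lemma valid_index_merge_list:
  assumes "valid_index ds ks" "m < n"
  shows "valid_index (merge_list i j n ds) (merge_list i j m ks)"
  using assms unfolding valid_index_def merge_list_def delete_pos_def
  by (intro list_all2_appendI list_all2_takeI list_all2_dropI list_all2_update_cong)

lemma entry_cvec:
  assumes "1 \<le> i" "i < j" "j \<le> length (dims B)" "valid_index (dims B) ks"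
  shows "entry (cvec i j B)
      (merge_list i j (ks ! (j - 1) * dims B ! (i - 1) + ks ! (i - 1)) ks) = entry B ks"
proof -
  define Ni Nj ki kj where d: "Ni = dims B ! (i - 1)" "Nj = dims B ! (j - 1)"
    "ki = ks ! (i - 1)" "kj = ks ! (j - 1)"
  have len: "length ks = length (dims B)"
    using assms(4) by (simp add: valid_index_def list_all2_lengthD)
  have k: "ki < Ni" "kj < Nj"
    using assms len list_all2_nthD[of "(<)" ks "dims B"] unfolding d valid_index_def by auto
  have "kj * Ni + ki < Suc kj * Ni" using k by simp
  also have "\<dots> \<le> Ni * Nj" using k mult_le_mono1[of "Suc kj" Nj Ni] by (simp add: mult.commute)
  finally have "kj * Ni + ki < Ni * Nj" .
  then have "valid_index (merge_list i j (Ni * Nj) (dims B)) (merge_list i j (kj * Ni + ki) ks)"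
    using assms(4) by (intro valid_index_merge_list)
  moreover have "unmerge_list i j ki kj (merge_list i j m ks) = ks" for m
    using unmerge_merge_list[of i j ks m] assms len by (simp add: d)
  moreover have "merge_list i j m ks ! (i - 1) = m" for m
    using nth_merge_list[of i j ks m] assms len by simp
  ultimately show ?thesis
    using k unfolding cvec_def Let_def entry_tensor d[symmetric] by simp
qed

lemma entry_rvec:
  assumes "1 \<le> i" "i < j" "j \<le> length (dims B)" "valid_index (dims B) ks"
  shows "entry (rvec i j B)
      (merge_list i j (ks ! (i - 1) * dims B ! (j - 1) + ks ! (j - 1)) ks) = entry B ks"
proof -
  define Ni Nj ki kj where d: "Ni = dims B ! (i - 1)" "Nj = dims B ! (j - 1)"
    "ki = ks ! (i - 1)" "kj = ks ! (j - 1)"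
  have len: "length ks = length (dims B)"
    using assms(4) by (simp add: valid_index_def list_all2_lengthD)
  have k: "ki < Ni" "kj < Nj"
    using assms len list_all2_nthD[of "(<)" ks "dims B"] unfolding d valid_index_def by auto
  have "ki * Nj + kj < Suc ki * Nj" using k by simp
  also have "\<dots> \<le> Ni * Nj" using k mult_le_mono1[of "Suc ki" Ni Nj] by simp
  finally have "ki * Nj + kj < Ni * Nj" .
  then have "valid_index (merge_list i j (Ni * Nj) (dims B)) (merge_list i j (ki * Nj + kj) ks)"
    using assms(4) by (intro valid_index_merge_list)
  moreover have "unmerge_list i j ki kj (merge_list i j m ks) = ks" for m
    using unmerge_merge_list[of i j ks m] assms len by (simp add: d)
  moreover have "merge_list i j m ks ! (i - 1) = m" for m
    using nth_merge_list[of i j ks m] assms len by simp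
  ultimately show ?thesis
    using k unfolding rvec_def Let_def entry_tensor d[symmetric] by simp
qed

definition frobenius_sq :: "real mat \<Rightarrow> real" where
  "frobenius_sq F = (\<Sum>i<dim_row F. \<Sum>j<dim_col F. (F $$ (i, j))\<^sup>2)"

definition loss ::
  "nat \<Rightarrow> (nat \<Rightarrow> real mat) \<Rightarrow> (nat \<Rightarrow> real mat) \<Rightarrow> (nat \<Rightarrow> real vec) \<Rightarrow> tensor \<Rightarrow> real" where
  "loss Ns Y Z \<nu> T = 1 / 2 * (\<Sum>s=1..Ns. frobenius_sq (Z s - contract_last T (\<nu> s) * Y s))"

definition B_hat ::
  "nat \<Rightarrow> nat \<Rightarrow> nat \<Rightarrow> (nat \<Rightarrow> real mat) \<Rightarrow> (nat \<Rightarrow> real vec) \<Rightarrow> real mat" where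
  "B_hat r p Ns Y \<nu> = mat_of_tensor (rvec 1 2 (cvec 3 4 (sum_tensor [p, r, r, p]
     (\<lambda>s. tensor_of_vec (\<nu> s) \<otimes>\<^sub>t tensor_of_mat (Y s * transpose_mat (Y s)) \<otimes>\<^sub>t tensor_of_vec (\<nu> s))
     {1..Ns})))"

definition C_hat ::
  "nat \<Rightarrow> nat \<Rightarrow> nat \<Rightarrow> (nat \<Rightarrow> real mat) \<Rightarrow> (nat \<Rightarrow> real mat) \<Rightarrow> (nat \<Rightarrow> real vec) \<Rightarrow> real mat" where
  "C_hat r p Ns Y Z \<nu> = mat_of_tensor (cvec 2 3 (sum_tensor [r, r, p]
     (\<lambda>s. tensor_of_mat (Z s * transpose_mat (Y s)) \<otimes>\<^sub>t tensor_of_vec (\<nu> s))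
     {1..Ns}))"

text \<open>The entries in coordinates.\<close>

lemma index_mat_of_tensor_cvec23:
  assumes "dims T = [n, r, p]" "a < n" "b < r" "x < p"
  shows "mat_of_tensor (cvec 2 3 T) $$ (a, x * r + b) = entry T [a, b, x]"
proof -
  have "valid_index (dims T) [a, b, x]" using assms by simp
  moreover have "x * r + b < r * p"
  proof -
    have "x * r + b < Suc x * r" using assms by simp
    also have "\<dots> \<le> r * p" using assms mult_le_mono1[of "Suc x" p r] by (simp add: mult.commute)
    finally show ?thesis .
  qed
  ultimately show ?thesis using assms entry_cvec[of 2 3 T "[a, b, x]"]
    by (simp add: mat_of_tensor_def cvec_def merge_list_def delete_pos_def)
qed

lemma index_C_hat:
  assumes "\<And>s. s \<in> {1..Ns} \<Longrightarrow> Y s \<in> carrier_mat r Nt"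
    and "\<And>s. s \<in> {1..Ns} \<Longrightarrow> Z s \<in> carrier_mat r Nt"
    and "\<And>s. s \<in> {1..Ns} \<Longrightarrow> \<nu> s \<in> carrier_vec p"
    and "a < r" "b < r" "x < p"
  shows "C_hat r p Ns Y Z \<nu> $$ (a, x * r + b) =
    (\<Sum>s=1..Ns. (Z s * transpose_mat (Y s)) $$ (a, b) * \<nu> s $ x)"
proof -
  have "dim_row (Y s) = r \<and> dim_row (Z s) = r \<and> dim_vec (\<nu> s) = p" if "s \<in> {1..Ns}" for s
    using assms(1-3)[OF that] by auto
  then show ?thesis using assms(4-)
    by (simp add: C_hat_def index_mat_of_tensor_cvec23 sum_tensor_def entry_tensor
        outer_prod_def tensor_of_mat_def tensor_of_vec_def)
qed

lemma index_B_hat: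
  assumes "\<And>s. s \<in> {1..Ns} \<Longrightarrow> Y s \<in> carrier_mat r Nt"
    and "\<And>s. s \<in> {1..Ns} \<Longrightarrow> \<nu> s \<in> carrier_vec p"
    and "x < p" "i < r" "y < p" "j < r"
  shows "B_hat r p Ns Y \<nu> $$ (x * r + i, y * r + j) =
    (\<Sum>s=1..Ns. \<nu> s $ x * (Y s * transpose_mat (Y s)) $$ (i, j) * \<nu> s $ y)"
proof -
  define A where "A = sum_tensor [p, r, r, p]
     (\<lambda>s. tensor_of_vec (\<nu> s) \<otimes>\<^sub>t tensor_of_mat (Y s * transpose_mat (Y s)) \<otimes>\<^sub>t tensor_of_vec (\<nu> s))
     {1..Ns}"
  have dA: "dims A = [p, r, r, p]" by (simp add: A_def sum_tensor_def)
  define C where "C = cvec 3 4 A"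
  have dC: "dims C = [p, r, r * p]"
    by (simp add: C_def cvec_def dA merge_list_def delete_pos_def eval_nat_numeral)
  have dR: "dims (rvec 1 2 C) = [p * r, r * p]"
    by (simp add: rvec_def dC merge_list_def delete_pos_def eval_nat_numeral)
  have bound: "u * r + v < p * r" if "u < p" "v < r" for u v
  proof -
    have "u * r + v < Suc u * r" using that by simp
    also have "\<dots> \<le> p * r" using that by (intro mult_le_mono1) simp
    finally show ?thesis .
  qed
  have bx: "x * r + i < p * r" and byj: "y * r + j < r * p"
    using bound[of x i] bound[of y j] assms by (simp_all add: mult.commute)
  have "entry (rvec 1 2 C) [x * r + i, y * r + j] = entry C [x, i, y * r + j]"
    using entry_rvec[of 1 2 C "[x, i, y * r + j]"] assms byj
    by (simp add: dC merge_list_def delete_pos_def eval_nat_numeral)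
  also have "\<dots> = entry A [x, i, j, y]"
    using entry_cvec[of 3 4 A "[x, i, j, y]"] assms
    unfolding C_def by (simp add: dA merge_list_def delete_pos_def eval_nat_numeral)
  also have "\<dots> = (\<Sum>s=1..Ns. \<nu> s $ x * (Y s * transpose_mat (Y s)) $$ (i, j) * \<nu> s $ y)"
  proof -
    have "dim_row (Y s) = r \<and> dim_vec (\<nu> s) = p" if "s \<in> {1..Ns}" for s
      using assms(1,2)[OF that] by auto
    then show ?thesis using assms(3-)
      by (simp add: A_def sum_tensor_def entry_tensor outer_prod_def tensor_of_mat_def
          tensor_of_vec_def mult.assoc)
  qed
  finally show ?thesis using bx byj
    unfolding B_hat_def A_def[symmetric] C_def[symmetric] mat_of_tensor_def dR by simp
qed

end

theory Submission
  imports Defs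
begin

text \<open>
  The loss is a linear least squares problem in the entries of the tensor, with one residual for
  each triple of a sample, a row and a column. Expanding the sum of squares around a point shows
  that minimality is equivalent to the normal equations, and these are the given system entry by
  entry once the merged index is split again.
\<close>

section \<open>Least squares and the normal equations\<close>

text \<open>The residual at \<open>x + d\<close> is the residual at \<open>x\<close> minus
  \<open>A d\<close>, so squaring gives an exact second-order expansion. Moving \<open>A\<close> to
  the other side of the inner product leaves \<open>d j\<close> against minus half the
  gradient.\<close>

lemma sum_squares_shift:
  fixes A :: "'i \<Rightarrow> 'j \<Rightarrow> real"
  shows "(\<Sum>i\<in>I. (z i - (\<Sum>j\<in>J. A i j * (x j + d j)))\<^sup>2) =
    (\<Sum>i\<in>I. (z i - (\<Sum>j\<in>J. A i j * x j))\<^sup>2)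
    - 2 * (\<Sum>j\<in>J. d j * (\<Sum>i\<in>I. A i j * (z i - (\<Sum>j\<in>J. A i j * x j))))
    + (\<Sum>i\<in>I. (\<Sum>j\<in>J. A i j * d j)\<^sup>2)"
proof -
  define e where "e i = z i - (\<Sum>j\<in>J. A i j * x j)" for i
  have "(z i - (\<Sum>j\<in>J. A i j * (x j + d j)))\<^sup>2 =
      (e i)\<^sup>2 - 2 * (\<Sum>j\<in>J. d j * (A i j * e i)) + (\<Sum>j\<in>J. A i j * d j)\<^sup>2" for i
  proof -
    have "z i - (\<Sum>j\<in>J. A i j * (x j + d j)) = e i - (\<Sum>j\<in>J. A i j * d j)"
      by (simp add: e_def distrib_left sum.distrib)
    moreover have "(\<Sum>j\<in>J. d j * (A i j * e i)) = e i * (\<Sum>j\<in>J. A i j * d j)"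
      by (simp add: sum_distrib_left mult_ac)
    ultimately show ?thesis by (simp add: power2_diff)
  qed
  moreover have "(\<Sum>i\<in>I. \<Sum>j\<in>J. d j * (A i j * e i)) = (\<Sum>j\<in>J. d j * (\<Sum>i\<in>I. A i j * e i))"
    by (subst sum.swap) (simp add: sum_distrib_left)
  ultimately show ?thesis
    by (simp add: e_def[symmetric] sum.distrib sum_subtractf sum_distrib_left[symmetric])
qed

text \<open>For small \<open>t\<close> of the sign of \<open>g\<close> the linear term dominates and
  would make the polynomial negative.\<close>

lemma quadratic_nonneg_imp_linear_zero:
  fixes g q :: real
  assumes "\<And>t. 0 \<le> t\<^sup>2 * q - 2 * (t * g)" and "0 \<le> q"
  shows "g = 0"
proof (rule ccontr)
  assume "g \<noteq> 0"
  \<comment> \<open>The parabola has its vertex at \<open>g / q\<close>; the denominator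
    \<open>q + 1\<close> also covers \<open>q = 0\<close> and still gives a negative value.\<close>
  have "(g / (q + 1))\<^sup>2 * q - 2 * (g / (q + 1) * g) = - (g\<^sup>2 * (q + 2) / (q + 1)\<^sup>2)"
    using \<open>0 \<le> q\<close> by (simp add: field_simps power2_eq_square add_nonneg_eq_0_iff)
  moreover have "g\<^sup>2 * (q + 2) / (q + 1)\<^sup>2 > 0"
    using \<open>g \<noteq> 0\<close> \<open>0 \<le> q\<close> by (intro divide_pos_pos mult_pos_pos) auto
  ultimately show False using assms(1)[of "g / (q + 1)"] by simp
qed

text \<open>The residual at a minimizer is orthogonal to every column of \<open>A\<close>. One
  direction varies a single coordinate; in the other the linear term of the expansion vanishes and a
  sum of squares remains.\<close>

lemma normal_equations:
  fixes A :: "'i \<Rightarrow> 'j \<Rightarrow> real"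
  assumes "finite J"
  shows "(\<forall>y. (\<Sum>i\<in>I. (z i - (\<Sum>j\<in>J. A i j * x j))\<^sup>2) \<le> (\<Sum>i\<in>I. (z i - (\<Sum>j\<in>J. A i j * y j))\<^sup>2))
    \<longleftrightarrow> (\<forall>j\<in>J. (\<Sum>i\<in>I. A i j * (z i - (\<Sum>j\<in>J. A i j * x j))) = 0)"
    (is "(\<forall>y. ?L x \<le> ?L y) \<longleftrightarrow> (\<forall>j\<in>J. ?g j = 0)")
proof
  assume min: "\<forall>y. ?L x \<le> ?L y"
  show "\<forall>j\<in>J. ?g j = 0"
  proof
    fix k assume k: "k \<in> J"
    show "?g k = 0"
    proof (rule quadratic_nonneg_imp_linear_zero)
      fix t :: real
      \<comment> \<open>Along coordinate \<open>k\<close> the expansion is a quadratic polynomial in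
        \<open>t\<close> whose leading coefficient is the squared norm of column
        \<open>k\<close>.\<close>
      define d where "d j = (if k = j then t else 0)" for j
      have "(\<Sum>j\<in>J. d j * ?g j) = t * ?g k" "(\<Sum>j\<in>J. A i j * d j) = A i k * t" for i
        using k assms by (simp_all add: d_def if_distrib if_distribR sum.delta' cong: if_cong)
      then have "?L (\<lambda>j. x j + d j) = ?L x - 2 * (t * ?g k) + t\<^sup>2 * (\<Sum>i\<in>I. (A i k)\<^sup>2)"
        unfolding sum_squares_shift by (simp add: power_mult_distrib sum_distrib_left mult.commute)
      then show "0 \<le> t\<^sup>2 * (\<Sum>i\<in>I. (A i k)\<^sup>2) - 2 * (t * ?g k)"
        using min[rule_format, of "\<lambda>j. x j + d j"] by linarith
    qed (simp add: sum_nonneg)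
  qed
next
  assume g: "\<forall>j\<in>J. ?g j = 0"
  show "\<forall>y. ?L x \<le> ?L y"
  proof
    fix y
    have "?L y = ?L x + (\<Sum>i\<in>I. (\<Sum>j\<in>J. A i j * (y j - x j))\<^sup>2)"
      using sum_squares_shift[of z A x "\<lambda>j. y j - x j" J I] g by simp
    then show "?L x \<le> ?L y" by (simp add: sum_nonneg)
  qed
qed

text \<open>Cuts the range into \<open>p\<close> consecutive blocks of length \<open>r\<close>,
  which undoes the merged index of \<open>cvec 2 3\<close>.\<close>

lemma sum_lessThan_mult:
  fixes f :: "nat \<Rightarrow> 'a::comm_monoid_add"
  shows "(\<Sum>l<r * p. f l) = (\<Sum>y<p. \<Sum>j<r. f (y * r + j))"
  using sum.nat_group[of f r p]
  by (simp add: sum.shift_bounds_nat_ivl mult.commute add.commute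
      sum.atLeastLessThan_shift_0 atLeast0LessThan)

section \<open>The loss as a least squares problem\<close>

text \<open>The derivative of the fitted value at sample \<open>s\<close>, row \<open>a\<close>, column \<open>t\<close> with respect to the tensor entry at \<open>[a', b, x]\<close>.\<close>

definition design :: "(nat \<Rightarrow> real mat) \<Rightarrow> (nat \<Rightarrow> real vec) \<Rightarrow>
    nat \<times> nat \<times> nat \<Rightarrow> nat \<times> nat \<times> nat \<Rightarrow> real" where
  "design Y \<nu> = (\<lambda>(s, a, t) (a', b, x). if a = a' then \<nu> s $ x * Y s $$ (b, t) else 0)"

text \<open>Row \<open>a\<close> of the fitted matrix depends only on row \<open>a\<close> of the
  tensor, so the sum over \<open>a'\<close> collapses.\<close>

lemma sum_design:
  assumes "a < r"
  shows "(\<Sum>j\<in>{..<r} \<times> {..<r} \<times> {..<p}. design Y \<nu> (s, a, t) j * f j) =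
    (\<Sum>b<r. \<Sum>x<p. \<nu> s $ x * Y s $$ (b, t) * f (a, b, x))"
proof -
  have "(\<Sum>j\<in>{..<r} \<times> {..<r} \<times> {..<p}. design Y \<nu> (s, a, t) j * f j) =
    (\<Sum>a'<r. if a = a' then \<Sum>b<r. \<Sum>x<p. \<nu> s $ x * Y s $$ (b, t) * f (a', b, x) else 0)"
    unfolding sum.cartesian_product' design_def by (intro sum.cong refl) simp
  then show ?thesis using assms by (simp add: sum.delta')
qed

text \<open>The same collapse for the transposed design matrix, as it occurs in the
  gradient.\<close>

lemma sum_design_left:
  assumes "a < r"
  shows "(\<Sum>i\<in>S \<times> {..<r} \<times> {..<n}. design Y \<nu> i (a, b, x) * f i) =
    (\<Sum>s\<in>S. \<Sum>t<n. \<nu> s $ x * Y s $$ (b, t) * f (s, a, t))"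
proof -
  have "(\<Sum>i\<in>S \<times> {..<r} \<times> {..<n}. design Y \<nu> i (a, b, x) * f i) =
    (\<Sum>s\<in>S. \<Sum>a'<r. if a' = a then \<Sum>t<n. \<nu> s $ x * Y s $$ (b, t) * f (s, a', t) else 0)"
    unfolding sum.cartesian_product' design_def by (intro sum.cong refl) simp
  then show ?thesis using assms by (simp add: sum.delta)
qed

text \<open>Turns a tensor into a vector of unknowns indexed like the columns of
  \<open>design\<close>.\<close>

abbreviation entry3 :: "tensor \<Rightarrow> nat \<times> nat \<times> nat \<Rightarrow> real" where
  "entry3 T \<equiv> (\<lambda>(a, b, x). entry T [a, b, x])"

lemma loss_eq_sum_squares:
  assumes "\<And>s. s \<in> {1..Ns} \<Longrightarrow> Y s \<in> carrier_mat r Nt"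
    and "\<And>s. s \<in> {1..Ns} \<Longrightarrow> Z s \<in> carrier_mat r Nt"
    and "T \<in> carrier_tensor [r, r, p]"
  shows "loss Ns Y Z \<nu> T = 1 / 2 * (\<Sum>i\<in>{1..Ns} \<times> {..<r} \<times> {..<Nt}.
    ((\<lambda>(s, a, t). Z s $$ (a, t)) i -
     (\<Sum>j\<in>{..<r} \<times> {..<r} \<times> {..<p}. design Y \<nu> i j * entry3 T j))\<^sup>2)"
proof -
  have d: "dims T = [r, r, p]" using assms(3) by (simp add: carrier_tensor_def)
  have "frobenius_sq (Z s - contract_last T (\<nu> s) * Y s) =
    (\<Sum>a<r. \<Sum>t<Nt. (Z s $$ (a, t) - (\<Sum>b<r. \<Sum>x<p. \<nu> s $ x * Y s $$ (b, t) * entry T [a, b, x]))\<^sup>2)"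
    if s: "s \<in> {1..Ns}" for s
  proof -
    have "(Z s - contract_last T (\<nu> s) * Y s) $$ (a, t) =
      Z s $$ (a, t) - (\<Sum>b<r. \<Sum>x<p. \<nu> s $ x * Y s $$ (b, t) * entry T [a, b, x])"
      if "a < r" "t < Nt" for a t
      using that assms(1,2)[OF s]
      by (simp add: contract_last_def d scalar_prod_def sum_distrib_left atLeast0LessThan mult_ac)
    then show ?thesis
      using assms(1,2)[OF s] by (simp add: frobenius_sq_def contract_last_def d)
  qed
  then show ?thesis
    unfolding loss_def sum.cartesian_product'[of _ "{1..Ns}"]
      sum.cartesian_product'[of _ "{..<r}" "{..<Nt}"]
    by (simp add: sum_design)
qed

lemma is_arg_min_loss_iff:
  assumes "\<And>s. s \<in> {1..Ns} \<Longrightarrow> Y s \<in> carrier_mat r Nt"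
    and "\<And>s. s \<in> {1..Ns} \<Longrightarrow> Z s \<in> carrier_mat r Nt"
    and T: "T \<in> carrier_tensor [r, r, p]"
  shows "is_arg_min (loss Ns Y Z \<nu>) (\<lambda>S. S \<in> carrier_tensor [r, r, p]) T \<longleftrightarrow>
    (\<forall>a<r. \<forall>b<r. \<forall>x<p. (\<Sum>s=1..Ns. \<Sum>t<Nt. \<nu> s $ x * Y s $$ (b, t) * (Z s $$ (a, t) -
      (\<Sum>b'<r. \<Sum>x'<p. \<nu> s $ x' * Y s $$ (b', t) * entry T [a, b', x']))) = 0)"
proof -
  define I where "I = {1..Ns} \<times> {..<r} \<times> {..<Nt}"
  define J where "J = {..<r} \<times> {..<r} \<times> {..<p}"
  define z where "z = (\<lambda>(s, a, t). Z s $$ (a, t))"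
  define L where "L y = (\<Sum>i\<in>I. (z i - (\<Sum>j\<in>J. design Y \<nu> i j * y j))\<^sup>2)" for y
  have loss: "loss Ns Y Z \<nu> S = 1 / 2 * L (entry3 S)" if "S \<in> carrier_tensor [r, r, p]" for S
    using loss_eq_sum_squares[of Ns Y r Nt Z S p \<nu>, OF assms(1,2) that]
    by (simp add: L_def I_def J_def z_def)
  have "is_arg_min (loss Ns Y Z \<nu>) (\<lambda>S. S \<in> carrier_tensor [r, r, p]) T \<longleftrightarrow>
      (\<forall>S\<in>carrier_tensor [r, r, p]. L (entry3 T) \<le> L (entry3 S))"
    using T by (auto simp: is_arg_min_linorder loss)
  also have "\<dots> \<longleftrightarrow> (\<forall>y. L (entry3 T) \<le> L y)"
  proof safe
    fix y
    assume min: "\<forall>S\<in>carrier_tensor [r, r, p]. L (entry3 T) \<le> L (entry3 S)"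
    \<comment> \<open>\<open>normal_equations\<close> ranges over all functions \<open>y\<close>,
      while tensor entries vanish outside the index range. Truncating \<open>y\<close> to a tensor
      does not change \<open>L\<close>, which reads \<open>y\<close> only on
      \<open>J\<close>.\<close>
    define S where "S = tensor [r, r, p] (\<lambda>ks. y (ks ! 0, ks ! 1, ks ! 2))"
    have "L y = L (entry3 S)" unfolding L_def
      by (intro sum.cong arg_cong2[where f = "(-)"] arg_cong[where f = "\<lambda>u. u\<^sup>2"] refl)
         (auto simp: S_def J_def entry_tensor)
    then show "L (entry3 T) \<le> L y" using min by (simp add: S_def carrier_tensor_def)
  qed auto
  also have "\<dots> \<longleftrightarrow>
      (\<forall>j\<in>J. (\<Sum>i\<in>I. design Y \<nu> i j * (z i - (\<Sum>j\<in>J. design Y \<nu> i j * entry3 T j))) = 0)"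
    unfolding L_def by (rule normal_equations) (simp add: J_def)
  also have "\<dots> \<longleftrightarrow> (\<forall>a<r. \<forall>b<r. \<forall>x<p. (\<Sum>s=1..Ns. \<Sum>t<Nt. \<nu> s $ x * Y s $$ (b, t) *
      (Z s $$ (a, t) - (\<Sum>b'<r. \<Sum>x'<p. \<nu> s $ x' * Y s $$ (b', t) * entry T [a, b', x']))) = 0)"
    by (auto simp: I_def J_def sum_design_left sum_design z_def)
  finally show ?thesis .
qed

section \<open>The linear system entry by entry\<close>

lemma nat_mult_split:
  fixes k :: nat
  assumes "k < p * r"
  obtains x i where "k = x * r + i" "x < p" "i < r"
proof
  show "k = k div r * r + k mod r" by simp
  show "k div r < p" using assms by (simp add: less_mult_imp_div_less)
  show "k mod r < r" using assms by (cases r) auto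
qed

text \<open>The order of the factors follows the positions merged: \<open>rvec 1 2\<close> joins
  sizes \<open>p, r\<close>, whereas \<open>cvec 3 4\<close> and \<open>cvec 2 3\<close> join
  \<open>r, p\<close>. Hence the later uses of \<open>mult.commute[of r p]\<close>.\<close>

lemma dim_vectorized [simp]:
  "dim_row (B_hat r p Ns Y \<nu>) = p * r" "dim_col (B_hat r p Ns Y \<nu>) = r * p"
  "dim_row (C_hat r p Ns Y Z \<nu>) = r" "dim_col (C_hat r p Ns Y Z \<nu>) = r * p"
  by (simp_all add: B_hat_def C_hat_def mat_of_tensor_def rvec_def cvec_def sum_tensor_def
      merge_list_def delete_pos_def eval_nat_numeral)

text \<open>Up to a positive factor, the transpose of \<open>C_hat - T B_hat^T\<close>, with
  \<open>T\<close> vectorized, is minus the gradient of the loss: its entry at row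
  \<open>x * r + b\<close> and column \<open>a\<close> is the normal equation for
  \<open>[a, b, x]\<close>.\<close>

lemma system_iff:
  assumes Y: "\<And>s. s \<in> {1..Ns} \<Longrightarrow> Y s \<in> carrier_mat r Nt"
    and Z: "\<And>s. s \<in> {1..Ns} \<Longrightarrow> Z s \<in> carrier_mat r Nt"
    and \<nu>: "\<And>s. s \<in> {1..Ns} \<Longrightarrow> \<nu> s \<in> carrier_vec p"
    and T: "T \<in> carrier_tensor [r, r, p]"
  shows "B_hat r p Ns Y \<nu> * transpose_mat (mat_of_tensor (cvec 2 3 T)) =
      transpose_mat (C_hat r p Ns Y Z \<nu>) \<longleftrightarrow>
    (\<forall>a<r. \<forall>b<r. \<forall>x<p. (\<Sum>s=1..Ns. \<Sum>t<Nt. \<nu> s $ x * Y s $$ (b, t) * (Z s $$ (a, t) -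
      (\<Sum>b'<r. \<Sum>x'<p. \<nu> s $ x' * Y s $$ (b', t) * entry T [a, b', x']))) = 0)"
proof -
  let ?M = "mat_of_tensor (cvec 2 3 T)"
  let ?B = "B_hat r p Ns Y \<nu>"
  let ?C = "C_hat r p Ns Y Z \<nu>"
  have d: "dims T = [r, r, p]" using T by (simp add: carrier_tensor_def)
  have dM: "dim_row ?M = r" "dim_col ?M = r * p"
    by (simp_all add: mat_of_tensor_def cvec_def d merge_list_def delete_pos_def eval_nat_numeral)
  have bound: "x * r + b < p * r" if "x < p" "b < r" for x b
  proof -
    have "x * r + b < Suc x * r" using that by simp
    also have "\<dots> \<le> p * r" using that by (intro mult_le_mono1) simp
    finally show ?thesis .
  qed
  have entry_eq: "(transpose_mat ?C - ?B * transpose_mat ?M) $$ (x * r + b, a) =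
      (\<Sum>s=1..Ns. \<Sum>t<Nt. \<nu> s $ x * Y s $$ (b, t) * (Z s $$ (a, t) -
      (\<Sum>b'<r. \<Sum>x'<p. \<nu> s $ x' * Y s $$ (b', t) * entry T [a, b', x'])))"
    if abx: "a < r" "b < r" "x < p" for a b x
  proof -
    have YY: "(Y s * transpose_mat (Y s)) $$ (b, b') = (\<Sum>t<Nt. Y s $$ (b, t) * Y s $$ (b', t))"
      if "s \<in> {1..Ns}" "b' < r" for s b'
      using Y[OF that(1)] that abx by (simp add: scalar_prod_def atLeast0LessThan)
    have ZY: "(Z s * transpose_mat (Y s)) $$ (a, b) = (\<Sum>t<Nt. Z s $$ (a, t) * Y s $$ (b, t))"
      if "s \<in> {1..Ns}" for s
      using Y[OF that] Z[OF that] abx by (simp add: scalar_prod_def atLeast0LessThan)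
    have "(?B * transpose_mat ?M) $$ (x * r + b, a) =
        (\<Sum>l<r * p. ?B $$ (x * r + b, l) * ?M $$ (a, l))"
      using abx bound[of x b] dM by (simp add: scalar_prod_def atLeast0LessThan)
    \<comment> \<open>Splitting the contracted index into blocks lets \<open>index_B_hat\<close> and
      \<open>index_mat_of_tensor_cvec23\<close> evaluate each factor.\<close>
    also have "\<dots> = (\<Sum>x'<p. \<Sum>b'<r. ?B $$ (x * r + b, x' * r + b') * ?M $$ (a, x' * r + b'))"
      by (rule sum_lessThan_mult)
    also have "\<dots> = (\<Sum>x'<p. \<Sum>b'<r. \<Sum>s=1..Ns. \<Sum>t<Nt.
        \<nu> s $ x * Y s $$ (b, t) * (\<nu> s $ x' * Y s $$ (b', t) * entry T [a, b', x']))"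
    proof (intro sum.cong refl)
      fix x' b' assume "x' \<in> {..<p}" "b' \<in> {..<r}"
      then have x': "x' < p" and b': "b' < r" by simp_all
      have "?B $$ (x * r + b, x' * r + b') =
          (\<Sum>s=1..Ns. \<nu> s $ x * (\<Sum>t<Nt. Y s $$ (b, t) * Y s $$ (b', t)) * \<nu> s $ x')"
        using index_B_hat[OF Y \<nu> abx(3,2) x' b'] YY[OF _ b'] by simp
      moreover have "?M $$ (a, x' * r + b') = entry T [a, b', x']"
        by (rule index_mat_of_tensor_cvec23[OF d abx(1) b' x'])
      ultimately show "?B $$ (x * r + b, x' * r + b') * ?M $$ (a, x' * r + b') = (\<Sum>s=1..Ns. \<Sum>t<Nt.
          \<nu> s $ x * Y s $$ (b, t) * (\<nu> s $ x' * Y s $$ (b', t) * entry T [a, b', x']))"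
        by (simp add: sum_distrib_left sum_distrib_right mult_ac)
    qed
    also have "\<dots> = (\<Sum>b'<r. \<Sum>x'<p. \<Sum>s=1..Ns. \<Sum>t<Nt.
        \<nu> s $ x * Y s $$ (b, t) * (\<nu> s $ x' * Y s $$ (b', t) * entry T [a, b', x']))"
      by (rule sum.swap)
    also have "\<dots> = (\<Sum>s=1..Ns. \<Sum>b'<r. \<Sum>x'<p. \<Sum>t<Nt.
        \<nu> s $ x * Y s $$ (b, t) * (\<nu> s $ x' * Y s $$ (b', t) * entry T [a, b', x']))"
      \<comment> \<open>Fixing one range of \<open>sum.swap\<close> lets it move only the sum over
        samples, in one direction, so the rewriting terminates.\<close>
      by (simp only: sum.swap[of _ _ "{1..Ns}"])
    also have "\<dots> = (\<Sum>s=1..Ns. \<Sum>t<Nt. \<Sum>b'<r. \<Sum>x'<p.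
        \<nu> s $ x * Y s $$ (b, t) * (\<nu> s $ x' * Y s $$ (b', t) * entry T [a, b', x']))"
      by (simp only: sum.swap[of _ _ "{..<Nt}"])
    finally have "(?B * transpose_mat ?M) $$ (x * r + b, a) =
      (\<Sum>s=1..Ns. \<Sum>t<Nt. \<Sum>b'<r. \<Sum>x'<p.
        \<nu> s $ x * Y s $$ (b, t) * (\<nu> s $ x' * Y s $$ (b', t) * entry T [a, b', x']))" .
    moreover have "?C $$ (a, x * r + b) =
        (\<Sum>s=1..Ns. \<Sum>t<Nt. \<nu> s $ x * Y s $$ (b, t) * Z s $$ (a, t))"
      using index_C_hat[OF Y Z \<nu> abx] by (simp add: ZY sum_distrib_left mult_ac)
    ultimately show ?thesis
      using abx bound[of x b] dM
      by (simp add: mult.commute[of r p] right_diff_distrib sum_subtractf sum_distrib_left)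
  qed
  have "?B * transpose_mat ?M = transpose_mat ?C \<longleftrightarrow>
      (\<forall>k<p * r. \<forall>a<r. (transpose_mat ?C - ?B * transpose_mat ?M) $$ (k, a) = 0)"
    using dM by (auto simp: mat_eq_iff mult.commute[of r p])
  also have "\<dots> \<longleftrightarrow> (\<forall>a<r. \<forall>b<r. \<forall>x<p.
      (transpose_mat ?C - ?B * transpose_mat ?M) $$ (x * r + b, a) = 0)"
    \<comment> \<open>The map from \<open>x\<close> and \<open>b\<close> to \<open>x * r + b\<close>
      reaches every row index below \<open>p * r\<close> and no other.\<close>
    using bound by (metis nat_mult_split)
  finally show ?thesis by (simp add: entry_eq)
qed

theorem theorem2p1:
  fixes r p Nt Ns :: nat
    and Y Z :: "nat \<Rightarrow> real mat"
    and \<nu> :: "nat \<Rightarrow> real vec"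
    and T :: tensor
  assumes "r > 0" and "p > 0" and "Nt > 0" and "Ns > 0"
    and "\<And>s. s \<in> {1..Ns} \<Longrightarrow> Y s \<in> carrier_mat r Nt"
    and "\<And>s. s \<in> {1..Ns} \<Longrightarrow> Z s \<in> carrier_mat r Nt"
    and "\<And>s. s \<in> {1..Ns} \<Longrightarrow> \<nu> s \<in> carrier_vec p"
    and "T \<in> carrier_tensor [r, r, p]"
  shows "is_arg_min (loss Ns Y Z \<nu>) (\<lambda>S. S \<in> carrier_tensor [r, r, p]) T \<longleftrightarrow>
    B_hat r p Ns Y \<nu> * transpose_mat (mat_of_tensor (cvec 2 3 T)) =
      transpose_mat (C_hat r p Ns Y Z \<nu>)"
  \<comment> \<open>Minimality and the matrix equation are both equivalent to the same scalar
    equations.\<close>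
  using is_arg_min_loss_iff[of Ns Y r Nt Z T p \<nu>] system_iff[of Ns Y r Nt Z \<nu> p T] assms(5-)
  by simp

end
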